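(* Let $G=(V,E)$ be a graph containing exactly $k$ triangles, and let $m$ denote the number of vertices of $G$ that do not lie on any triangle. Then the $\Delta$-rank satisfies $d_\Delta(G)\leq m+2k$.
   Context: All graphs are finite, simple, undirected and connected. A triangle is a set of three pairwise adjacent vertices (a copy of $K_3$). For $S\subseteq V$, the $\Delta$-interval $[S]$ is the set consisting of all vertices of $S$ together with every vertex $v\in V$ that is adjacent to both $x$ and $y$ for some pair of adjacent vertices $x,y\in S$. A set $S$ is $\Delta$-convex if $[S]=S$. The $\Delta$-convex hull $\langle S\rangle$ is the smallest $\Delta$-convex set containing $S$ (note $\langle\emptyset\rangle=\emptyset$). A set $S\subseteq V$ is convexly independent if $a\notin\langle S\setminus\{a\}\rangle$ for every $a\in S$, and convexly dependent otherwise. The rank $d_\Delta(G)$ is the least integer $n\ge0$ such that every $S\subseteq V$ with $|S|>n$ is convexly dependent (equivalently, the maximum size of a convexly independent set). *)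

theory Defs
  imports "Graph_Theory.Graph_Theory"
begin

definition triangles :: "('a, 'b) pre_digraph \<Rightarrow> 'a set set" where
  "triangles G =
    {T. T \<subseteq> verts G \<and> card T = 3 \<and> (\<forall>u\<in>T. \<forall>v\<in>T. u \<noteq> v \<longrightarrow> u \<rightarrow>\<^bsub>G\<^esub> v)}"

definition delta_interval :: "('a, 'b) pre_digraph \<Rightarrow> 'a set \<Rightarrow> 'a set" where
  "delta_interval G S =
    S \<union> {v \<in> verts G. \<exists>x\<in>S. \<exists>y\<in>S. x \<rightarrow>\<^bsub>G\<^esub> y \<and> v \<rightarrow>\<^bsub>G\<^esub> x \<and> v \<rightarrow>\<^bsub>G\<^esub> y}"

definition delta_convex :: "('a, 'b) pre_digraph \<Rightarrow> 'a set \<Rightarrow> bool" where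
  "delta_convex G S \<longleftrightarrow> S \<subseteq> verts G \<and> delta_interval G S = S"

text \<open>The generic hull operator intersects all \<^const>\<open>delta_convex\<close> supersets. This family contains
  \<^term>\<open>verts G\<close> whenever \<^prop>\<open>S \<subseteq> verts G\<close>; for other sets the hull is \<^term>\<open>UNIV\<close>.\<close>

definition delta_hull :: "('a, 'b) pre_digraph \<Rightarrow> 'a set \<Rightarrow> 'a set" where
  "delta_hull G S = delta_convex G hull S"

definition convexly_independent :: "('a, 'b) pre_digraph \<Rightarrow> 'a set \<Rightarrow> bool" where
  "convexly_independent G S \<longleftrightarrow> (\<forall>a\<in>S. a \<notin> delta_hull G (S - {a}))"

abbreviation convexly_dependent :: "('a, 'b) pre_digraph \<Rightarrow> 'a set \<Rightarrow> bool" where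
  "convexly_dependent G S \<equiv> \<not> convexly_independent G S"

definition delta_rank :: "('a, 'b) pre_digraph \<Rightarrow> nat" where
  "delta_rank G = (LEAST n. \<forall>S \<subseteq> verts G. card S > n \<longrightarrow> convexly_dependent G S)"

lemma delta_convex_verts: "delta_convex G (verts G)"
  by (auto simp: delta_convex_def delta_interval_def)

lemma delta_convex_delta_hull:
  assumes "S \<subseteq> verts G"
  shows "delta_convex G (delta_hull G S)"
proof -
  have "delta_hull G S \<subseteq> verts G"
    unfolding delta_hull_def by (rule hull_minimal) (use assms delta_convex_verts in auto)
  moreover have "delta_interval G (delta_hull G S) \<subseteq> delta_hull G S"
  proof -
    have "delta_interval G (delta_hull G S) \<subseteq> C" if C: "S \<subseteq> C" "delta_convex G C" for C
    proof -
      have "delta_hull G S \<subseteq> C"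
        unfolding delta_hull_def using C by (rule hull_minimal)
      then have "delta_interval G (delta_hull G S) \<subseteq> delta_interval G C"
        by (auto simp: delta_interval_def)
      then show ?thesis using C by (simp add: delta_convex_def)
    qed
    then show ?thesis
      unfolding delta_hull_def hull_def by (intro Inter_greatest) simp
  qed
  ultimately show ?thesis
    unfolding delta_convex_def by (auto simp: delta_interval_def)
qed

lemma delta_hull_least:
  assumes "S \<subseteq> C" "delta_convex G C"
  shows "delta_hull G S \<subseteq> C"
  unfolding delta_hull_def using assms by (rule hull_minimal)

lemma delta_hull_empty: "delta_hull G {} = {}"
  using delta_hull_least[of "{}" "{}" G] by (auto simp: delta_convex_def delta_interval_def)

lemma delta_rank_eq_Max:
  assumes "finite (verts G)"
  shows "delta_rank G = Max (card ` {S. S \<subseteq> verts G \<and> convexly_independent G S})"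
proof -
  let ?I = "{S. S \<subseteq> verts G \<and> convexly_independent G S}"
  have fin: "finite (card ` ?I)" using assms by simp
  have "{} \<in> ?I" by (simp add: convexly_independent_def)
  then have ne: "card ` ?I \<noteq> {}" by blast
  show ?thesis
    unfolding delta_rank_def
  proof (rule Least_equality)
    show "\<forall>S \<subseteq> verts G. card S > Max (card ` ?I) \<longrightarrow> convexly_dependent G S"
    proof (intro allI impI notI)
      fix S assume "S \<subseteq> verts G" "card S > Max (card ` ?I)" "convexly_independent G S"
      moreover from this have "card S \<le> Max (card ` ?I)" by (intro Max_ge[OF fin]) blast
      ultimately show False by linarith
    qed
  next
    fix n assume n: "\<forall>S \<subseteq> verts G. card S > n \<longrightarrow> convexly_dependent G S"
    show "Max (card ` ?I) \<le> n"
    proof (rule Max.boundedI[OF fin ne])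
      fix c assume "c \<in> card ` ?I"
      then obtain S where "S \<subseteq> verts G" "convexly_independent G S" "c = card S" by blast
      then show "c \<le> n" using n by (meson not_le)
    qed
  qed
qed

end

(* A convexly independent set contains no whole triangle, since each vertex of
   a triangle lies in the hull of the other two. So it has at most two vertices in each triangle,
   besides vertices that lie on no triangle. *)
theory Submission
  imports Defs
begin

text \<open>Any \<open>S\<close> containing the other two vertices is allowed, so that the lemma
  applies directly to the sets \<open>S - {a}\<close> by which convex independence is
  tested.\<close>

lemma triangle_vertex_in_hull:
  assumes "T \<in> triangles G" "a \<in> T" "T - {a} \<subseteq> S"
  shows "a \<in> delta_hull G S"
proof (cases "S \<subseteq> verts G")
  case True
  have T: "card T = 3" "T \<subseteq> verts G"
    "\<And>u v. u \<in> T \<Longrightarrow> v \<in> T \<Longrightarrow> u \<noteq> v \<Longrightarrow> u \<rightarrow>\<^bsub>G\<^esub> v"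
    using assms(1) by (auto simp: triangles_def)
  then have "card (T - {a}) = 2"
    using assms(2) by (simp add: card_Diff_singleton)
  then obtain x y where xy: "T - {a} = {x, y}" "x \<noteq> y"
    by (auto simp: card_2_iff)
  then have mem: "x \<in> T" "y \<in> T" "x \<noteq> a" "y \<noteq> a" by auto
  have "S \<subseteq> delta_hull G S"
    unfolding delta_hull_def by (rule hull_subset)
  then have "x \<in> delta_hull G S" "y \<in> delta_hull G S"
    using assms(3) xy by auto
  \<comment> \<open>The edge between \<open>x\<close> and \<open>y\<close> lies in the hull and
    \<open>a\<close> is adjacent to both ends, so one interval step reaches \<open>a\<close>;
    convexity of the hull then absorbs it.\<close>
  then have "a \<in> delta_interval G (delta_hull G S)"
    unfolding delta_interval_def using T mem xy(2) assms(2) by blast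
  then show ?thesis
    using delta_convex_delta_hull[OF True] by (simp add: delta_convex_def)
next
  case False
  \<comment> \<open>Convex sets lie within \<open>verts G\<close>, so none contains \<open>S\<close>
    and the hull is an intersection over the empty family.\<close>
  then have "delta_hull G S = UNIV"
    by (auto simp: delta_hull_def hull_def delta_convex_def)
  then show ?thesis by simp
qed

lemma card_independent_Int_triangle_le:
  assumes "convexly_independent G S" "T \<in> triangles G"
  shows "card (S \<inter> T) \<le> 2"
proof -
  have T: "card T = 3" using assms(2) by (simp add: triangles_def)
  then have "finite T" "T \<noteq> {}" by (auto intro: card_ge_0_finite)
  have "\<not> T \<subseteq> S"
  proof
    assume "T \<subseteq> S"
    obtain a where a: "a \<in> T" using \<open>T \<noteq> {}\<close> by blast
    then have "a \<in> delta_hull G (S - {a})"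
      using \<open>T \<subseteq> S\<close> by (intro triangle_vertex_in_hull[OF assms(2)]) auto
    then show False
      using assms(1) a \<open>T \<subseteq> S\<close> by (auto simp: convexly_independent_def)
  qed
  \<comment> \<open>Now \<open>S \<inter> T\<close> is a proper subset of the finite set
    \<open>T\<close>.\<close>
  then have "card (S \<inter> T) < card T"
    using \<open>finite T\<close> by (intro psubset_card_mono) auto
  then show ?thesis using T by simp
qed

lemma card_convexly_independent_le:
  assumes "finite (verts G)" "S \<subseteq> verts G" "convexly_independent G S"
  shows "card S \<le> card {v \<in> verts G. \<forall>T \<in> triangles G. v \<notin> T} + 2 * card (triangles G)"
proof -
  let ?N = "{v \<in> verts G. \<forall>T \<in> triangles G. v \<notin> T}"
  let ?U = "\<Union>T\<in>triangles G. S \<inter> T"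
  have "triangles G \<subseteq> Pow (verts G)" by (auto simp: triangles_def)
  then have fin: "finite (triangles G)"
    using assms(1) by (simp add: finite_subset)
  have finS: "finite S" using assms(1,2) finite_subset by blast
  \<comment> \<open>A vertex of \<open>S\<close> outside \<open>?N\<close> lies on some triangle
    \<open>T\<close>, hence in its trace \<open>S \<inter> T\<close>. Traces of different triangles
    may overlap, so their sizes only bound \<open>card ?U\<close> from above.\<close>
  have "card S \<le> card (?N \<union> ?U)"
    by (rule card_mono) (use assms(1,2) fin finS in auto)
  also have "\<dots> \<le> card ?N + card ?U" by (rule card_Un_le)
  also have "card ?U \<le> (\<Sum>T\<in>triangles G. card (S \<inter> T))"
    by (rule card_UN_le[OF fin])
  also have "\<dots> \<le> (\<Sum>T\<in>triangles G. 2)"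
    by (intro sum_mono card_independent_Int_triangle_le[OF assms(3)])
  finally show ?thesis by simp
qed

theorem theorem6:
  fixes G :: "('a, 'b) pre_digraph" and k m :: nat
  assumes "graph G"
    and "connected G"
    and "card (triangles G) = k"
    and "m = card {v \<in> verts G. \<forall>T \<in> triangles G. v \<notin> T}"
  shows "delta_rank G \<le> m + 2 * k"
proof -
  interpret graph G by fact
  show ?thesis
    unfolding delta_rank_def
    \<comment> \<open>It suffices that \<open>m + 2 * k\<close> has the property whose least witness
      is the rank; this is the contrapositive of the bound on independent sets.\<close>
    by (rule Least_le)
      (use card_convexly_independent_le[OF finite_verts] assms(3,4) in \<open>fastforce simp: not_le[symmetric]\<close>)
qed

end
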